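(* Let a quaternion function $f(z)$ be defined on some neighborhood of a point $z^0\in\mathbb{H}$ and let a quaternion function $F(w)$ be defined on some neighborhood of the point $w^0=f(z^0)$. Assume that $f$ is $\mathbb{H}$-differentiable at $z^0$ and that $F$ is $\mathbb{H}$-differentiable at $w^0$. If $F'(w^0)=\sum_k A_kB_k$, where $A_k,B_k$ are sequences of quaternions representing the increment of $F$ at $w^0$, i.e. $F(w^0+h)-F(w^0)=\sum_k A_k\,h\,B_k+o(h)$, then the composite $Ff$, $z\mapsto F(f(z))$, is $\mathbb{H}$-differentiable at $z^0$ and $$(Ff)'(z^0)=\sum_k A_k\, f'(z^0)\, B_k .$$
   Context: $\mathbb{H}$ denotes the algebra of real quaternions with its usual norm $|\cdot|$. A quaternion function $f$ defined on a neighborhood $G\subset\mathbb{H}$ of a point $z^0$ is called $\mathbb{H}$-differentiable at $z^0$ if there exist two (finite or infinite) sequences of quaternions $A_k=A_k(z^0)$, $B_k=B_k(z^0)$ such that $\sum_k A_kB_k$ is finite (converges) and, for $z^0+h\in G$, $$f(z^0+h)-f(z^0)=\sum_k A_k\, h\, B_k+\omega(z^0,h),\qquad \lim_{h\to0}\frac{|\omega(z^0,h)|}{|h|}=0.$$ In this case the quaternion $f'(z^0)=\sum_k A_kB_k$ is called the $\mathbb{H}$-derivative of $f$ at $z^0$. The symbol $o(h)$ denotes any function $\omega(z^0,h)$ with $\lim_{h\to0}|\omega(z^0,h)|/|h|=0$. *)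

theory Defs
  imports "HOL-Analysis.Analysis"
begin

section \<open>The real quaternions\<close>

text \<open>\<open>Quat a b c d\<close> is the quaternion \<open>a + b i + c j + d k\<close>.\<close>

datatype quat = Quat (qre: real) (qi: real) (qj: real) (qk: real)

lemma quat_eq_iff: "x = y \<longleftrightarrow> qre x = qre y \<and> qi x = qi y \<and> qj x = qj y \<and> qk x = qk y"
  by (cases x; cases y) simp

instantiation quat :: ring_1
begin

definition "0 = Quat 0 0 0 0"
definition "1 = Quat 1 0 0 0"
definition "x + y = Quat (qre x + qre y) (qi x + qi y) (qj x + qj y) (qk x + qk y)"
definition "- x = Quat (- qre x) (- qi x) (- qj x) (- qk x)"
definition "x - y = Quat (qre x - qre y) (qi x - qi y) (qj x - qj y) (qk x - qk y)"
definition "x * y = Quat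
  (qre x * qre y - qi x * qi y - qj x * qj y - qk x * qk y)
  (qre x * qi y + qi x * qre y + qj x * qk y - qk x * qj y)
  (qre x * qj y - qi x * qk y + qj x * qre y + qk x * qi y)
  (qre x * qk y + qi x * qj y - qj x * qi y + qk x * qre y)"

instance
  by standard
    (simp_all add: quat_eq_iff zero_quat_def one_quat_def plus_quat_def uminus_quat_def
      minus_quat_def times_quat_def algebra_simps)

end

lemma quat_sel_simps [simp]:
  "qre 0 = 0" "qi 0 = 0" "qj 0 = 0" "qk 0 = 0"
  "qre 1 = 1" "qi 1 = 0" "qj 1 = 0" "qk 1 = 0"
  "qre (x + y) = qre x + qre y" "qi (x + y) = qi x + qi y"
  "qj (x + y) = qj x + qj y" "qk (x + y) = qk x + qk y"
  "qre (- x) = - qre x" "qi (- x) = - qi x" "qj (- x) = - qj x" "qk (- x) = - qk x"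
  "qre (x - y) = qre x - qre y" "qi (x - y) = qi x - qi y"
  "qj (x - y) = qj x - qj y" "qk (x - y) = qk x - qk y"
  "qre (x * y) = qre x * qre y - qi x * qi y - qj x * qj y - qk x * qk y"
  "qi (x * y) = qre x * qi y + qi x * qre y + qj x * qk y - qk x * qj y"
  "qj (x * y) = qre x * qj y - qi x * qk y + qj x * qre y + qk x * qi y"
  "qk (x * y) = qre x * qk y + qi x * qj y - qj x * qi y + qk x * qre y"
  by (simp_all add: zero_quat_def one_quat_def plus_quat_def uminus_quat_def
      minus_quat_def times_quat_def)

instantiation quat :: real_algebra_1
begin

definition "scaleR r x = Quat (r * qre x) (r * qi x) (r * qj x) (r * qk x)"

instance
  by standard (simp_all add: quat_eq_iff scaleR_quat_def algebra_simps)

end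

lemma quat_sel_scaleR [simp]:
  "qre (r *\<^sub>R x) = r * qre x" "qi (r *\<^sub>R x) = r * qi x"
  "qj (r *\<^sub>R x) = r * qj x" "qk (r *\<^sub>R x) = r * qk x"
  by (simp_all add: scaleR_quat_def)

instantiation quat :: real_inner
begin

definition inner_quat :: "quat \<Rightarrow> quat \<Rightarrow> real" where
  "inner_quat x y = qre x * qre y + qi x * qi y + qj x * qj y + qk x * qk y"
definition norm_quat :: "quat \<Rightarrow> real" where
  "norm_quat x = sqrt ((qre x)\<^sup>2 + (qi x)\<^sup>2 + (qj x)\<^sup>2 + (qk x)\<^sup>2)"
definition sgn_quat :: "quat \<Rightarrow> quat" where
  "sgn_quat x = x /\<^sub>R norm x"
definition dist_quat :: "quat \<Rightarrow> quat \<Rightarrow> real" where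
  "dist_quat x y = norm (x - y)"
definition uniformity_quat :: "(quat \<times> quat) filter" where
  "uniformity_quat = (INF e\<in>{0<..}. principal {(x, y). dist x y < e})"
definition open_quat :: "quat set \<Rightarrow> bool" where
  "open_quat U \<longleftrightarrow> (\<forall>x\<in>U. eventually (\<lambda>(x', y). x' = x \<longrightarrow> y \<in> U) uniformity)"

instance
proof
  fix x y z :: quat and r :: real
  show "inner x y = inner y x" "inner (x + y) z = inner x z + inner y z"
    "inner (r *\<^sub>R x) y = r * inner x y" "0 \<le> inner x x" "norm x = sqrt (inner x x)"
    by (simp_all add: inner_quat_def norm_quat_def algebra_simps power2_eq_square)
  have "qre x * qre x + qi x * qi x + qj x * qj x + qk x * qk x = 0 \<longleftrightarrow>
      qre x = 0 \<and> qi x = 0 \<and> qj x = 0 \<and> qk x = 0"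
    by (simp add: add_nonneg_eq_0_iff)
  then show "inner x x = 0 \<longleftrightarrow> x = 0"
    unfolding inner_quat_def quat_eq_iff quat_sel_simps .
qed (simp_all add: sgn_quat_def dist_quat_def uniformity_quat_def open_quat_def)

end

lemma quat_norm_squared: "(norm x)\<^sup>2 = (qre x)\<^sup>2 + (qi x)\<^sup>2 + (qj x)\<^sup>2 + (qk x)\<^sup>2"
  by (simp add: norm_quat_def)

instantiation quat :: division_ring
begin

text \<open>The inverse is the conjugate divided by the squared norm.\<close>

definition inverse_quat :: "quat \<Rightarrow> quat" where
  "inverse_quat x = Quat (qre x) (- qi x) (- qj x) (- qk x) /\<^sub>R (norm x)\<^sup>2"
definition divide_quat :: "quat \<Rightarrow> quat \<Rightarrow> quat" where
  "divide_quat x y = x * inverse y"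

instance
proof
  fix x y :: quat
  let ?c = "Quat (qre x) (- qi x) (- qj x) (- qk x)"
  have c: "?c * x = (norm x)\<^sup>2 *\<^sub>R 1" "x * ?c = (norm x)\<^sup>2 *\<^sub>R 1"
    by (simp_all add: quat_eq_iff quat_norm_squared) (simp_all add: power2_eq_square)
  show "inverse x * x = 1" "x * inverse x = 1" if "x \<noteq> 0"
    using that by (simp_all add: inverse_quat_def c)
  show "x div y = x * inverse y"
    by (rule divide_quat_def)
  show "inverse (0::quat) = 0"
    by (simp add: inverse_quat_def quat_eq_iff)
qed

end

instance quat :: real_normed_div_algebra
proof
  fix x y :: quat
  have "(norm (x * y))\<^sup>2 = (norm x)\<^sup>2 * (norm y)\<^sup>2"
    unfolding quat_norm_squared quat_sel_simps
    by (simp only: power2_eq_square algebra_simps)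
  then have "(norm (x * y))\<^sup>2 = (norm x * norm y)\<^sup>2"
    by (simp only: power_mult_distrib)
  then show "norm (x * y) = norm x * norm y"
    by (simp only: power2_eq_iff_nonneg norm_ge_zero mult_nonneg_nonneg)
qed

section \<open>H-differentiability\<close>

text \<open>
  A function defined on a neighbourhood \<open>G\<close> of \<open>z\<close> is a total function together with a set \<open>G\<close>
  having \<open>z\<close> in its interior; its values outside \<open>G\<close> are irrelevant.

  The predicate below says that \<open>f(z + h) - f(z) = (\<Sum>k. A k h B k) + o(h)\<close> for \<open>z + h \<in> G\<close>.
  Convergence of the series for each such \<open>h\<close> is explicit.  Series are ordinary ordered series,
  not assumed to converge absolutely.  A finite sequence of coefficients is an infinite one
  padded with zeros.
\<close>

definition H_increment ::
  "(quat \<Rightarrow> quat) \<Rightarrow> quat set \<Rightarrow> quat \<Rightarrow> (nat \<Rightarrow> quat) \<Rightarrow> (nat \<Rightarrow> quat) \<Rightarrow> bool"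
where
  "H_increment f G z A B \<longleftrightarrow>
     (\<exists>\<omega>. (\<forall>h. z + h \<in> G \<longrightarrow>
              summable (\<lambda>k. A k * h * B k) \<and>
              f (z + h) - f z = (\<Sum>k. A k * h * B k) + \<omega> h) \<and>
          ((\<lambda>h. norm (\<omega> h) / norm h) \<longlongrightarrow> 0) (at 0))"

definition has_H_derivative :: "(quat \<Rightarrow> quat) \<Rightarrow> quat set \<Rightarrow> quat \<Rightarrow> quat \<Rightarrow> bool" where
  "has_H_derivative f G z D \<longleftrightarrow>
     z \<in> interior G \<and> (\<exists>A B. H_increment f G z A B \<and> (\<lambda>k. A k * B k) sums D)"

definition H_differentiable :: "(quat \<Rightarrow> quat) \<Rightarrow> quat set \<Rightarrow> quat \<Rightarrow> bool" where
  "H_differentiable f G z \<longleftrightarrow> (\<exists>D. has_H_derivative f G z D)"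

definition H_deriv :: "(quat \<Rightarrow> quat) \<Rightarrow> quat set \<Rightarrow> quat \<Rightarrow> quat" where
  "H_deriv f G z = (THE D. has_H_derivative f G z D)"

text \<open>
  The coefficient sequences are not unique, but the H-derivative is: it is the limit of the
  difference quotients along real increments.  Hence the definite description is justified.
\<close>

lemma has_H_derivative_real_quotient:
  assumes "has_H_derivative f G z D"
  shows "((\<lambda>t::real. (f (z + of_real t) - f z) /\<^sub>R t) \<longlongrightarrow> D) (at 0)"
proof -
  obtain A B \<omega> where z: "z \<in> interior G" and D: "(\<lambda>k. A k * B k) sums D"
    and eq: "\<And>h. z + h \<in> G \<Longrightarrow> f (z + h) - f z = (\<Sum>k. A k * h * B k) + \<omega> h"
    and lim: "((\<lambda>h. norm (\<omega> h) / norm h) \<longlongrightarrow> 0) (at 0)"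
    using assms unfolding has_H_derivative_def H_increment_def by auto
  have at0: "filterlim (of_real :: real \<Rightarrow> quat) (at 0) (at 0)"
    unfolding filterlim_at
  proof
    show "\<forall>\<^sub>F t in at 0. (of_real t :: quat) \<in> UNIV \<and> of_real t \<noteq> (0::quat)"
      by (simp add: eventually_at_filter)
    show "((\<lambda>t. of_real t :: quat) \<longlongrightarrow> 0) (at 0)"
      using tendsto_of_real[OF tendsto_ident_at, of 0 UNIV] by simp
  qed
  have "((\<lambda>t::real. z + of_real t) \<longlongrightarrow> z) (at 0)"
    using tendsto_add[OF tendsto_const[of z] tendsto_of_real[OF tendsto_ident_at[of 0 UNIV]]] by simp
  then have "\<forall>\<^sub>F t::real in at 0. z + of_real t \<in> interior G"
    by (rule topological_tendstoD) (simp_all add: z)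
  then have ev: "\<forall>\<^sub>F t::real in at 0.
      norm (\<omega> (of_real t)) / norm (of_real t :: quat)
        = norm ((f (z + of_real t) - f z) /\<^sub>R t - D)"
    using eventually_neq_at_within[of 0 0 UNIV]
  proof eventually_elim
    case (elim t)
    have "(\<lambda>k. t *\<^sub>R (A k * B k)) sums (t *\<^sub>R D)"
      using D by (rule sums_scaleR_right)
    then have "(\<Sum>k. A k * of_real t * B k) = t *\<^sub>R D"
      by (simp add: of_real_def sums_iff)
    moreover have "z + of_real t \<in> G"
      using elim interior_subset by blast
    ultimately have "f (z + of_real t) - f z = t *\<^sub>R D + \<omega> (of_real t)"
      using eq by simp
    with elim show ?case
      by (simp add: scaleR_add_right divide_inverse)
  qed
  have "((\<lambda>t::real. norm (\<omega> (of_real t)) / norm (of_real t :: quat)) \<longlongrightarrow> 0) (at 0)"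
    by (rule filterlim_compose[OF lim at0])
  then have "((\<lambda>t::real. norm ((f (z + of_real t) - f z) /\<^sub>R t - D)) \<longlongrightarrow> 0) (at 0)"
    using tendsto_cong[OF ev] by blast
  then show ?thesis
    by (metis Lim_null tendsto_norm_zero_iff)
qed

lemma has_H_derivative_unique:
  assumes "has_H_derivative f G z D" "has_H_derivative f G z D'"
  shows "D = D'"
  using assms[THEN has_H_derivative_real_quotient]
  by (rule tendsto_unique[rotated]) simp

lemma H_deriv_eq: "has_H_derivative f G z D \<Longrightarrow> H_deriv f G z = D"
  unfolding H_deriv_def by (rule the_equality) (auto intro: has_H_derivative_unique)

end

theory Submission
  imports Defs
begin

text \<open>
  Every real-linear map on the quaternions is a finite sum of sandwiches \<open>h \<mapsto> a h b\<close>, because the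
  real part is \<open>4 Re q = q - i q i - j q j - k q k\<close>.  Since a convergent sandwich series is
  real-linear, H-differentiability amounts to Frechet differentiability, and the classical chain
  rule applies.  The H-derivative is the value of the Frechet derivative at 1.
\<close>

definition sandwich :: "(quat \<times> quat) list \<Rightarrow> quat \<Rightarrow> quat" where
  "sandwich xs h = (\<Sum>(a, b)\<leftarrow>xs. a * h * b)"

lemma bounded_linear_sandwich: "bounded_linear (sandwich xs)"
proof (induction xs)
  case Nil
  show ?case by (simp add: sandwich_def[abs_def])
next
  case (Cons p xs)
  have "bounded_linear (\<lambda>h. fst p * h * snd p + sandwich xs h)"
    by (intro bounded_linear_add Cons.IH bounded_linear_mult_const bounded_linear_const_mult
        bounded_linear_ident)
  then show ?case by (simp add: sandwich_def[abs_def] case_prod_unfold)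
qed

text \<open>Passes from a finite list to the infinite coefficient sequences of
  \<open>H_increment\<close>, by zero padding; one pair of sequences serves every
  \<open>h\<close>.\<close>

lemma sandwich_sums:
  obtains A B where "\<And>h. (\<lambda>k. A k * h * B k) sums sandwich xs h"
proof
  fix h
  let ?A = "\<lambda>k. if k < length xs then fst (xs ! k) else 0"
  let ?B = "\<lambda>k. if k < length xs then snd (xs ! k) else 0"
  have "(\<lambda>k. ?A k * h * ?B k) sums (\<Sum>k<length xs. ?A k * h * ?B k)"
    by (rule sums_finite) auto
  also have "(\<Sum>k<length xs. ?A k * h * ?B k) = sandwich xs h"
    by (simp add: sandwich_def case_prod_unfold sum_list_sum_nth atLeast0LessThan)
  finally show "(\<lambda>k. ?A k * h * ?B k) sums sandwich xs h" .
qed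

text \<open>The map \<open>q \<mapsto> - i q i\<close> keeps the real and \<open>i\<close>
  components and negates the other two, and similarly for \<open>j\<close> and \<open>k\<close>. In
  the total every imaginary component cancels and the real part appears four times.\<close>

lemma quat_real_part:
  "q - Quat 0 1 0 0 * q * Quat 0 1 0 0 - Quat 0 0 1 0 * q * Quat 0 0 1 0
     - Quat 0 0 0 1 * q * Quat 0 0 0 1 = (4 * qre q) *\<^sub>R 1"
  by (simp add: quat_eq_iff)

lemma scaleR_qre_is_sandwich: "\<exists>xs. \<forall>h. qre (u * h) *\<^sub>R c = sandwich xs h"
proof (intro exI allI)
  fix h
  \<comment> \<open>Letters \<open>i\<close>, \<open>j\<close>, \<open>k\<close> stay arbitrary
    here, so that this is pure ring algebra; the units enter only with \<open>quat_real_part\<close>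
    for \<open>q = u * h\<close>.\<close>
  have expand: "sandwich [(c * u, 1), (- (c * i * u), i), (- (c * j * u), j), (- (c * k * u), k)] h
      = c * (u * h - i * (u * h) * i - j * (u * h) * j - k * (u * h) * k)" for c i j k
    by (simp add: sandwich_def algebra_simps)
  let ?c = "c /\<^sub>R 4" and ?i = "Quat 0 1 0 0" and ?j = "Quat 0 0 1 0" and ?k = "Quat 0 0 0 1"
  show "qre (u * h) *\<^sub>R c = sandwich
      [(?c * u, 1), (- (?c * ?i * u), ?i), (- (?c * ?j * u), ?j), (- (?c * ?k * u), ?k)] h"
    unfolding expand quat_real_part by simp
qed

lemma linear_is_sandwich:
  assumes "linear T"
  obtains xs where "T = sandwich xs"
proof -
  interpret linear T by fact
  let ?i = "Quat 0 1 0 0" and ?j = "Quat 0 0 1 0" and ?k = "Quat 0 0 0 1"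
  \<comment> \<open>The factors 1, \<open>-i\<close>, \<open>-j\<close>, \<open>-k\<close> turn
    \<open>qre (u * h)\<close> into the four coordinates of \<open>h\<close>, each of which
    multiplies the value of \<open>T\<close> at its basis vector.\<close>
  obtain xs1 xsi xsj xsk where R:
    "\<forall>h. qre (1 * h) *\<^sub>R T 1 = sandwich xs1 h"
    "\<forall>h. qre (- ?i * h) *\<^sub>R T ?i = sandwich xsi h"
    "\<forall>h. qre (- ?j * h) *\<^sub>R T ?j = sandwich xsj h"
    "\<forall>h. qre (- ?k * h) *\<^sub>R T ?k = sandwich xsk h"
    using scaleR_qre_is_sandwich[of 1 "T 1"] scaleR_qre_is_sandwich[of "- ?i" "T ?i"]
      scaleR_qre_is_sandwich[of "- ?j" "T ?j"] scaleR_qre_is_sandwich[of "- ?k" "T ?k"]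
    by (elim exE)
  let ?xs = "xs1 @ xsi @ xsj @ xsk"
  have "T h = sandwich ?xs h" for h
  proof -
    have "h = qre h *\<^sub>R 1 + qi h *\<^sub>R ?i + qj h *\<^sub>R ?j + qk h *\<^sub>R ?k"
      by (simp add: quat_eq_iff)
    then have "T h = T (qre h *\<^sub>R 1 + qi h *\<^sub>R ?i + qj h *\<^sub>R ?j + qk h *\<^sub>R ?k)"
      by (rule arg_cong)
    also have "\<dots> = qre h *\<^sub>R T 1 + qi h *\<^sub>R T ?i + qj h *\<^sub>R T ?j + qk h *\<^sub>R T ?k"
      by (simp only: add scale)
    also have "\<dots> = qre (1 * h) *\<^sub>R T 1 + qre (- ?i * h) *\<^sub>R T ?i
        + qre (- ?j * h) *\<^sub>R T ?j + qre (- ?k * h) *\<^sub>R T ?k"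
      by simp
    also have "\<dots> = sandwich ?xs h"
      unfolding R[rule_format] by (simp only: sandwich_def map_append sum_list_append add.assoc)
    finally show ?thesis .
  qed
  then show thesis by (intro that ext)
qed

lemma eventually_shift_in_interior:
  fixes z :: "'a::real_normed_vector"
  assumes "z \<in> interior G"
  shows "\<forall>\<^sub>F h in at 0. z + h \<in> G"
proof -
  have "\<forall>\<^sub>F x in at z. x \<in> G"
    using eventually_at_in_open'[OF open_interior assms]
    by eventually_elim (use interior_subset in blast)
  then show ?thesis
    by (simp add: at_to_0[of z] eventually_filtermap add.commute)
qed

lemma H_increment_has_derivative:
  assumes z: "z \<in> interior G" and inc: "H_increment f G z A B"
  obtains T where "\<And>h. (\<lambda>k. A k * h * B k) sums T h" "(f has_derivative T) (at z)"
proof -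
  obtain \<omega> where sm: "\<And>h. z + h \<in> G \<Longrightarrow> summable (\<lambda>k. A k * h * B k)"
    and eq: "\<And>h. z + h \<in> G \<Longrightarrow> f (z + h) - f z = (\<Sum>k. A k * h * B k) + \<omega> h"
    and lim: "((\<lambda>h. norm (\<omega> h) / norm h) \<longlongrightarrow> 0) (at 0)"
    using inc unfolding H_increment_def by auto
  define T where "T h = (\<Sum>k. A k * h * B k)" for h
  obtain e where e: "e > 0" "cball z e \<subseteq> G"
    using z mem_interior_cball by blast
  have sums: "(\<lambda>k. A k * h * B k) sums T h" for h
  proof (cases "h = 0")
    case False
    \<comment> \<open>Convergence is known only for increments staying in \<open>G\<close>.
      Rescaling \<open>h\<close> to norm \<open>e\<close> lands there, and real factors pull out of
      every term.\<close>
    define t where "t = e / norm h"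
    have t: "t \<noteq> 0" "z + t *\<^sub>R h \<in> G"
      using False e by (auto simp: t_def dist_norm)
    have "summable (\<lambda>k. inverse t *\<^sub>R (A k * (t *\<^sub>R h) * B k))"
      by (intro summable_scaleR_right sm t)
    then have "summable (\<lambda>k. A k * h * B k)"
      using t by simp
    then show ?thesis
      unfolding T_def by (rule summable_sums)
  qed (simp add: T_def)
  have "linear T"
  proof
    fix x y :: quat and r :: real
    have "(\<lambda>k. A k * (x + y) * B k) sums (T x + T y)"
      using sums_add[OF sums[of x] sums[of y]] by (simp add: algebra_simps)
    then show "T (x + y) = T x + T y"
      using sums sums_unique2 by blast
    have "(\<lambda>k. A k * (r *\<^sub>R x) * B k) sums (r *\<^sub>R T x)"
      using sums_scaleR_right[OF sums[of x], of r] by simp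
    then show "T (r *\<^sub>R x) = r *\<^sub>R T x"
      using sums sums_unique2 by blast
  qed
  \<comment> \<open>Boundedness comes from rewriting \<open>T\<close> as a finite sandwich, not from
    estimates on \<open>A\<close> and \<open>B\<close>.\<close>
  then have bl: "bounded_linear T"
    by (metis linear_is_sandwich bounded_linear_sandwich)
  have "\<forall>\<^sub>F h in at 0. norm (\<omega> h) / norm h = norm (f (z + h) - f z - T h) / norm h"
    using eventually_shift_in_interior[OF z] by eventually_elim (simp add: eq T_def)
  then have "((\<lambda>h. norm (f (z + h) - f z - T h) / norm h) \<longlongrightarrow> 0) (at 0)"
    using lim by (rule tendsto_cong[THEN iffD1])
  then have "(f has_derivative T) (at z)"
    using bl by (simp add: has_derivative_at)
  with sums show thesis by (rule that)
qed

lemma has_derivative_imp_has_H_derivative: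
  assumes z: "z \<in> interior G" and der: "(f has_derivative T) (at z)"
  shows "has_H_derivative f G z (T 1)"
proof -
  obtain xs where "T = sandwich xs"
    using der has_derivative_linear linear_is_sandwich by blast
  then obtain A B where sums: "\<And>h. (\<lambda>k. A k * h * B k) sums T h"
    using sandwich_sums by metis
  have "H_increment f G z A B"
    unfolding H_increment_def
  proof (intro exI conjI allI impI)
    \<comment> \<open>This instantiates the remainder as the Frechet error itself, so the increment
      equation becomes an identity.\<close>
    show "((\<lambda>h. norm (f (z + h) - f z - T h) / norm h) \<longlongrightarrow> 0) (at 0)"
      using der by (simp add: has_derivative_at)
  qed (use sums in \<open>simp_all add: sums_iff\<close>)
  moreover have "(\<lambda>k. A k * B k) sums T 1"
    using sums[of 1] by simp
  ultimately show ?thesis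
    using z unfolding has_H_derivative_def by blast
qed

theorem proposition3p9:
  fixes f F :: "quat \<Rightarrow> quat" and G K :: "quat set" and z0 :: quat and A B :: "nat \<Rightarrow> quat"
  assumes "z0 \<in> interior G" and "f z0 \<in> interior K"
    and "H_differentiable f G z0"
    and "H_differentiable F K (f z0)"
    and "H_increment F K (f z0) A B"
    and "(\<lambda>k. A k * B k) sums H_deriv F K (f z0)"
  shows "H_differentiable (F \<circ> f) {z \<in> G. f z \<in> K} z0 \<and>
    (\<lambda>k. A k * H_deriv f G z0 * B k) sums H_deriv (F \<circ> f) {z \<in> G. f z \<in> K} z0"
proof -
  let ?S = "{z \<in> G. f z \<in> K}"
  \<comment> \<open>\<open>M\<close> is expanded by the given \<open>A\<close> and \<open>B\<close>
    at every increment; for \<open>f\<close> below any representing sequences will do.\<close>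
  obtain M where M: "\<And>h. (\<lambda>k. A k * h * B k) sums M h" "(F has_derivative M) (at (f z0))"
    using H_increment_has_derivative assms(2,5) by blast
  obtain a b where "H_increment f G z0 a b"
    using assms(3) unfolding H_differentiable_def has_H_derivative_def by blast
  then obtain L where L: "(f has_derivative L) (at z0)"
    using H_increment_has_derivative assms(1) by blast
  \<comment> \<open>Continuity of \<open>f\<close> at \<open>z0\<close> makes the domain of the
    composite a neighbourhood of \<open>z0\<close>.\<close>
  have "\<forall>\<^sub>F z in nhds z0. f z \<in> interior K"
    using has_derivative_continuous[OF L] assms(2)
    by (simp add: continuous_at eventually_nhds_conv_at topological_tendstoD)
  moreover have "\<forall>\<^sub>F z in nhds z0. z \<in> interior G"
    using assms(1) by (simp add: eventually_nhds_in_open)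
  ultimately have "\<forall>\<^sub>F z in nhds z0. z \<in> ?S"
    by eventually_elim (use interior_subset in blast)
  then have z0: "z0 \<in> interior ?S"
    by (auto simp: eventually_nhds interior_def)
  have comp: "has_H_derivative (F \<circ> f) ?S z0 ((M \<circ> L) 1)"
    by (intro has_derivative_imp_has_H_derivative z0 diff_chain_at L M)
  moreover have "H_deriv f G z0 = L 1"
    by (intro H_deriv_eq has_derivative_imp_has_H_derivative assms(1) L)
  \<comment> \<open>The derivative of the composite is \<open>M (L 1)\<close>, and the series for
    \<open>M\<close> at the increment \<open>L 1\<close>, the H-derivative of \<open>f\<close>, is
    the claimed one.\<close>
  ultimately show ?thesis
    using M(1)[of "L 1"] by (auto simp: H_deriv_eq H_differentiable_def)
qed

end
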